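(* Let $n$ be a positive integer, let $A$ and $B$ be rings and let $R=A\times B$. Then $R$ is an $n$-OAF-ring if and only if $A$ and $B$ are both general ZPI-rings.
   Context: All rings are commutative with $1\neq 0$. A proper ideal $I$ of a ring $R$ is an $n$-OA ideal if whenever $a_1a_2\cdots a_{n+1}\in I$ for nonunits $a_1,\ldots,a_{n+1}\in R$, then $a_1a_2\cdots a_n\in I$ or $a_{n+1}\in I$. A ring $R$ is an $n$-OAF-ring if every proper ideal of $R$ is a product of finitely many $n$-OA ideals of $R$. A general ZPI-ring is a ring in which every proper ideal is a product of finitely many prime ideals. *)

theory Defs
  imports "HOL-Algebra.Algebra"
begin

text \<open>\<^locale>\<open>cring\<close> admits the zero ring, which is excluded here.\<close>

locale nonzero_cring = cring +
  assumes one_not_zero: "\<one> \<noteq> \<zero>"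

definition proper_ideal :: "'a set \<Rightarrow> ('a, 'm) ring_scheme \<Rightarrow> bool" where
  "proper_ideal I R \<longleftrightarrow> ideal I R \<and> I \<noteq> carrier R"

definition n_OA_ideal :: "nat \<Rightarrow> 'a set \<Rightarrow> ('a, 'm) ring_scheme \<Rightarrow> bool" where
  "n_OA_ideal n I R \<longleftrightarrow> proper_ideal I R \<and>
     (\<forall>a :: nat \<Rightarrow> 'a.
        (\<forall>i \<in> {1..n + 1}. a i \<in> carrier R - Units R) \<longrightarrow>
        (\<Otimes>\<^bsub>R\<^esub> i \<in> {1..n + 1}. a i) \<in> I \<longrightarrow>
        (\<Otimes>\<^bsub>R\<^esub> i \<in> {1..n}. a i) \<in> I \<or> a (n + 1) \<in> I)"

text \<open>The empty product is the unit ideal, so it is irrelevant when factoring proper ideals.\<close>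

definition ideal_list_prod :: "('a, 'm) ring_scheme \<Rightarrow> 'a set list \<Rightarrow> 'a set" where
  "ideal_list_prod R Is = foldr (ideal_prod R) Is (carrier R)"

definition n_OAF_ring :: "nat \<Rightarrow> ('a, 'm) ring_scheme \<Rightarrow> bool" where
  "n_OAF_ring n R \<longleftrightarrow> nonzero_cring R \<and>
     (\<forall>I. proper_ideal I R \<longrightarrow>
        (\<exists>Is. (\<forall>J \<in> set Is. n_OA_ideal n J R) \<and> I = ideal_list_prod R Is))"

definition general_ZPI_ring :: "('a, 'm) ring_scheme \<Rightarrow> bool" where
  "general_ZPI_ring R \<longleftrightarrow> nonzero_cring R \<and>
     (\<forall>I. proper_ideal I R \<longrightarrow>
        (\<exists>Is. (\<forall>P \<in> set Is. primeideal P R) \<and> I = ideal_list_prod R Is))"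

end

theory Submission
  imports Defs
begin

text \<open>The decisive feature of \<open>R = A \<times> B\<close> is the pair of nonzero elements \<open>e = (1, 0)\<close> and
  \<open>f = (0, 1)\<close> with \<open>e + f = 1\<close> and \<open>e f = 0\<close>.  In the presence of such a pair the
  \<open>n\<close>-OA ideals are exactly the prime ideals, whatever \<open>n \<ge> 1\<close> is.  The reason is that the idempotent
  nonunit \<open>e\<close> can be inserted as a factor without changing multiples of \<open>e\<close>, so a relation
  \<open>x y \<in> I\<close> with \<open>x\<close> a multiple of \<open>e\<close> and \<open>y\<close> a nonunit can be stretched to the relation
  \<open>x e \<cdots> e y \<in> I\<close> between \<open>n + 1\<close> nonunits, and the \<open>n\<close>-OA condition then returns
  \<open>x \<in> I\<close> or \<open>y \<in> I\<close>.  Applied to \<open>e f = 0\<close> this puts \<open>e\<close> or \<open>f\<close> into \<open>I\<close>, say \<open>f\<close>; then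
  membership of \<open>a\<close> in \<open>I\<close> is the same as membership of \<open>a e\<close>, and the same principle
  applied to \<open>a e\<close> and \<open>b e\<close> shows that \<open>I\<close> is prime
  (\<open>n_OA_ideal_prime_on_multiples\<close> and \<open>n_OA_ideal_imp_primeideal\<close>).

  Hence \<open>R\<close> is an \<open>n\<close>-OAF-ring if and only if it is a general ZPI-ring.  The latter property passes
  from \<open>R\<close> to \<open>A\<close> and \<open>B\<close> because these are homomorphic images of \<open>R\<close>
  (\<open>general_ZPI_ring_image\<close>).  Conversely every ideal of
  \<open>R\<close> has the form \<open>I \<times> J = (I \<times> B) (A \<times> J)\<close>, and prime factorizations of \<open>I\<close> and \<open>J\<close> lift
  along \<open>P \<mapsto> P \<times> B\<close> and \<open>Q \<mapsto> A \<times> Q\<close>, which preserve primality and products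
  (\<open>general_ZPI_ring_RDirProd_iff\<close>).\<close>

section \<open>\<open>n\<close>-OA ideals and prime ideals\<close>

lemma (in cring) primeideal_imp_n_OA_ideal:
  assumes "primeideal P R"
  shows "n_OA_ideal n P R"
proof -
  interpret P: primeideal P R by (rule assms)
  have "(\<Otimes> i \<in> {1..n}. a i) \<in> P \<or> a (n + 1) \<in> P"
    if a: "\<forall>i \<in> {1..n + 1}. a i \<in> carrier R - Units R"
      and prod: "(\<Otimes> i \<in> {1..n + 1}. a i) \<in> P" for a :: "nat \<Rightarrow> 'a"
  proof -
    have "{1..n + 1} = insert (n + 1) {1..n}" by auto
    hence "(\<Otimes> i \<in> {1..n + 1}. a i) = a (n + 1) \<otimes> (\<Otimes> i \<in> {1..n}. a i)"
      using a by (simp add: Pi_def)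
    moreover have "(\<Otimes> i \<in> {1..n}. a i) \<in> carrier R" "a (n + 1) \<in> carrier R"
      using a by (auto intro!: finprod_closed)
    ultimately show ?thesis using P.I_prime prod by metis
  qed
  thus ?thesis
    using P.is_ideal P.I_notcarr by (auto simp: n_OA_ideal_def proper_ideal_def)
qed

text \<open>Padding the product \<open>x y\<close> with \<open>n - 1\<close> copies of \<open>e\<close> between \<open>x\<close> and \<open>y\<close> leaves it unchanged
  and brings it to the length that the \<open>n\<close>-OA condition asks for.\<close>

lemma (in cring) n_OA_ideal_prime_on_multiples:
  assumes I: "n_OA_ideal n I R" and n: "n \<ge> 1"
    and x: "x \<in> carrier R" and y: "y \<in> carrier R - Units R" and e: "e \<in> carrier R - Units R"
    and xe: "x \<otimes> e = x" and xy: "x \<otimes> y \<in> I"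
  shows "x \<in> I \<or> y \<in> I"
proof -
  have x_nonunit: "x \<notin> Units R"
  proof
    assume "x \<in> Units R"
    hence "e = \<one>" using e xe x by (metis Diff_iff Units_l_cancel one_closed r_one)
    thus False using e by simp
  qed
  define a where "a i = (if i = 1 then x else if i = n + 1 then y else e)" for i :: nat
  have a: "\<forall>i \<in> {1..n + 1}. a i \<in> carrier R - Units R"
    using x x_nonunit y e by (auto simp: a_def)
  have "m \<le> n \<Longrightarrow> m \<ge> 1 \<Longrightarrow> (\<Otimes> i \<in> {1..m}. a i) = x" for m
  proof (induction m)
    case (Suc m)
    have "{1..Suc m} = insert (Suc m) {1..m}" by auto
    hence "(\<Otimes> i \<in> {1..Suc m}. a i) = a (Suc m) \<otimes> (\<Otimes> i \<in> {1..m}. a i)"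
      using a Suc.prems by (simp add: Pi_def)
    thus ?case
      using Suc x e xe by (cases "m = 0") (auto simp: a_def m_comm)
  qed simp
  hence padded: "(\<Otimes> i \<in> {1..n}. a i) = x" using n by simp
  have "{1..n + 1} = insert (n + 1) {1..n}" by auto
  hence "(\<Otimes> i \<in> {1..n + 1}. a i) = a (n + 1) \<otimes> (\<Otimes> i \<in> {1..n}. a i)"
    using a by (simp add: Pi_def)
  also have "\<dots> = x \<otimes> y"
    unfolding padded using n x y by (simp add: a_def m_comm)
  finally have "(\<Otimes> i \<in> {1..n + 1}. a i) \<in> I" using xy by simp
  hence "(\<Otimes> i \<in> {1..n}. a i) \<in> I \<or> a (n + 1) \<in> I"
    using I a unfolding n_OA_ideal_def by blast
  moreover have "a (n + 1) = y" using n by (simp add: a_def)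
  ultimately show ?thesis using padded by simp
qed

text \<open>Since \<open>e f = 0 \<in> I\<close>, one of \<open>e\<close> and \<open>f\<close> lies in \<open>I\<close>; primality then only has to be
  checked on multiples of the other one.\<close>

lemma (in cring) n_OA_ideal_imp_primeideal:
  assumes I: "n_OA_ideal n I R" and n: "n \<ge> 1"
    and ef: "e \<in> carrier R" "f \<in> carrier R" "e \<noteq> \<zero>" "f \<noteq> \<zero>" "e \<oplus> f = \<one>" "e \<otimes> f = \<zero>"
  shows "primeideal I R"
proof -
  have ideal: "ideal I R" and proper: "I \<noteq> carrier R"
    using I by (auto simp: n_OA_ideal_def proper_ideal_def)
  interpret ideal I R by (rule ideal)
  have idem: "g \<otimes> g = g"
    if "g \<in> carrier R" "h \<in> carrier R" "g \<oplus> h = \<one>" "g \<otimes> h = \<zero>" for g h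
    using that by (metis m_closed r_distr r_one r_zero)
  have nonunit: "g \<notin> Units R"
    if "g \<in> carrier R" "h \<in> carrier R" "h \<noteq> \<zero>" "g \<otimes> h = \<zero>" for g h
  proof
    assume "g \<in> Units R"
    moreover have "g \<otimes> h = g \<otimes> \<zero>" using that by simp
    ultimately show False using that Units_l_cancel[of g h \<zero>] by simp
  qed
  \<comment> \<open>Modulo \<open>h\<close>, every element is a multiple of \<open>g\<close>, where the padding principle applies.\<close>
  have prime: "primeideal I R"
    if g: "g \<in> carrier R" and h: "h \<in> carrier R" "h \<noteq> \<zero>" "g \<oplus> h = \<one>" "g \<otimes> h = \<zero>" "h \<in> I" for g h
  proof (rule primeidealI[OF ideal is_cring])
    show "carrier R \<noteq> I" using proper by simp
    fix a b
    assume a: "a \<in> carrier R" and b: "b \<in> carrier R" and ab: "a \<otimes> b \<in> I"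
    have gg: "g \<otimes> g = g" using idem g h by blast
    have g_nonunit: "g \<notin> Units R" using nonunit g h by blast
    have project: "c \<in> I" if c: "c \<in> carrier R" and cg: "c \<otimes> g \<in> I" for c
    proof -
      have "c = c \<otimes> g \<oplus> c \<otimes> h" using c g h by (metis r_distr r_one)
      moreover have "c \<otimes> h \<in> I" using c h I_l_closed by blast
      ultimately show ?thesis using cg a_closed by metis
    qed
    have "b \<otimes> g \<notin> Units R"
      using g_nonunit b g by (metis unit_factor m_comm)
    moreover have "(a \<otimes> g) \<otimes> g = a \<otimes> g" using a g gg by (simp add: m_assoc)
    moreover have "(a \<otimes> g) \<otimes> (b \<otimes> g) \<in> I"
    proof -
      have "(a \<otimes> g) \<otimes> (b \<otimes> g) = (a \<otimes> b) \<otimes> (g \<otimes> g)"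
        using a b g by (simp add: m_ac)
      thus ?thesis using ab g I_r_closed by simp
    qed
    ultimately have "a \<otimes> g \<in> I \<or> b \<otimes> g \<in> I"
      using n_OA_ideal_prime_on_multiples[OF I n, of "a \<otimes> g" "b \<otimes> g" g] a b g g_nonunit by simp
    thus "a \<in> I \<or> b \<in> I" using project a b by blast
  qed
  have fe: "f \<oplus> e = \<one>" "f \<otimes> e = \<zero>" using ef by (simp_all add: a_comm m_comm)
  have "e \<notin> Units R" "f \<notin> Units R" using nonunit ef fe by blast+
  moreover have "e \<otimes> e = e" using idem ef by blast
  moreover have "e \<otimes> f \<in> I" using ef zero_closed by simp
  ultimately have "e \<in> I \<or> f \<in> I"
    using n_OA_ideal_prime_on_multiples[OF I n, of e f e] ef by simp
  thus ?thesis using prime[of e f] prime[of f e] ef fe by blast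
qed

lemma (in cring) n_OAF_ring_iff_general_ZPI_ring:
  assumes "n \<ge> 1"
    and "e \<in> carrier R" "f \<in> carrier R" "e \<noteq> \<zero>" "f \<noteq> \<zero>" "e \<oplus> f = \<one>" "e \<otimes> f = \<zero>"
  shows "n_OAF_ring n R \<longleftrightarrow> general_ZPI_ring R"
proof -
  have "n_OA_ideal n I R \<longleftrightarrow> primeideal I R" for I
    using primeideal_imp_n_OA_ideal n_OA_ideal_imp_primeideal assms by blast
  thus ?thesis by (simp add: n_OAF_ring_def general_ZPI_ring_def)
qed

section \<open>Homomorphic images of general ZPI-rings\<close>

lemma (in ring) ideal_foldr_ideal_prod:
  assumes "\<forall>P \<in> set Ps. ideal P R" "ideal I R"
  shows "ideal (foldr (ideal_prod R) Ps I) R"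
  using assms by (induction Ps) (auto intro: ideal_prod_is_ideal)

lemma (in ring) ideal_list_prod_subset:
  assumes "\<forall>P \<in> set Ps. ideal P R" "P \<in> set Ps"
  shows "ideal_list_prod R Ps \<subseteq> P"
  using assms unfolding ideal_list_prod_def
proof (induction Ps)
  case (Cons Q Ps)
  hence "ideal (foldr (ideal_prod R) Ps (carrier R)) R"
    by (intro ideal_foldr_ideal_prod oneideal) auto
  hence "Q \<cdot> foldr (ideal_prod R) Ps (carrier R) \<subseteq> Q \<inter> foldr (ideal_prod R) Ps (carrier R)"
    using Cons.prems by (intro ideal_prod_inter) auto
  thus ?case using Cons by auto
qed simp

lemma (in ring_hom_ring) ideal_image:
  assumes "ideal I R" "h ` carrier R = carrier S"
  shows "ideal (h ` I) S"
proof (rule idealI[OF S.ring_axioms])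
  interpret I: ideal I R by (rule assms)
  show "subgroup (h ` I) (add_monoid S)"
    using img_is_add_subgroup[OF I.a_subgroup] .
  fix a x assume "a \<in> h ` I" "x \<in> carrier S"
  then obtain b y where ab: "b \<in> I" "a = h b" "y \<in> carrier R" "x = h y"
    using assms(2) by blast
  show "x \<otimes>\<^bsub>S\<^esub> a \<in> h ` I"
    using ab I.I_l_closed[of b y] I.Icarr by (metis hom_mult imageI)
  show "a \<otimes>\<^bsub>S\<^esub> x \<in> h ` I"
    using ab I.I_r_closed[of b y] I.Icarr by (metis hom_mult imageI)
qed

lemma (in ring_hom_ring) image_ideal_prod:
  assumes "ideal I R" "ideal J R"
  shows "h ` (I \<cdot>\<^bsub>R\<^esub> J) = (h ` I) \<cdot>\<^bsub>S\<^esub> (h ` J)"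
proof (intro equalityI subsetI)
  fix y assume "y \<in> h ` (I \<cdot>\<^bsub>R\<^esub> J)"
  then obtain x where "x \<in> I \<cdot>\<^bsub>R\<^esub> J" and y: "y = h x" by blast
  thus "y \<in> (h ` I) \<cdot>\<^bsub>S\<^esub> (h ` J)" unfolding y
  proof (induction x rule: ideal_prod.induct)
    case (prod i j)
    thus ?case using assms by (simp add: ideal.Icarr ideal_prod.prod)
  next
    case (sum s t)
    thus ?case
      using R.ideal_prod_in_carrier[OF assms] by (simp add: ideal_prod.sum subset_iff)
  qed
next
  fix y assume "y \<in> (h ` I) \<cdot>\<^bsub>S\<^esub> (h ` J)"
  thus "y \<in> h ` (I \<cdot>\<^bsub>R\<^esub> J)"
  proof (induction y rule: ideal_prod.induct)
    case (prod i j)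
    then obtain i' j' where "i' \<in> I" "i = h i'" "j' \<in> J" "j = h j'" by blast
    moreover from this have "i \<otimes>\<^bsub>S\<^esub> j = h (i' \<otimes> j')" using assms by (simp add: ideal.Icarr)
    ultimately show ?case by (auto intro: ideal_prod.prod)
  next
    case (sum s t)
    then obtain s' t' where st: "s' \<in> I \<cdot>\<^bsub>R\<^esub> J" "s = h s'" "t' \<in> I \<cdot>\<^bsub>R\<^esub> J" "t = h t'" by blast
    hence "s \<oplus>\<^bsub>S\<^esub> t = h (s' \<oplus> t')"
      using R.ideal_prod_in_carrier[OF assms] by (simp add: subset_iff)
    thus ?case using st by (auto intro: ideal_prod.sum)
  qed
qed

lemma (in ring_hom_ring) image_ideal_list_prod:
  assumes "\<forall>P \<in> set Ps. ideal P R" "h ` carrier R = carrier S"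
  shows "h ` ideal_list_prod R Ps = ideal_list_prod S (map (image h) Ps)"
  using assms unfolding ideal_list_prod_def
  by (induction Ps) (simp_all add: image_ideal_prod R.ideal_foldr_ideal_prod R.oneideal)

text \<open>Because \<open>P\<close> contains the kernel, membership in \<open>P\<close> can be tested after applying \<open>h\<close>.\<close>

lemma (in ring_hom_ring) primeideal_image:
  assumes P: "primeideal P R" and ker: "a_kernel R S h \<subseteq> P"
    and surj: "h ` carrier R = carrier S" and S: "cring S"
  shows "primeideal (h ` P) S"
proof -
  have diff_in_kernel: "x \<ominus> p \<in> a_kernel R S h"
    if "x \<in> carrier R" "p \<in> carrier R" "h x = h p" for x p
  proof -
    have "h (x \<ominus> p) = h x \<ominus>\<^bsub>S\<^esub> h p"
      using that unfolding a_minus_def by (metis R.a_inv_closed hom_a_inv hom_add)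
    also have "\<dots> = \<zero>\<^bsub>S\<^esub>"
      unfolding that(3) a_minus_def using that(2) by (intro S.r_neg hom_closed)
    finally show ?thesis using R.minus_closed[OF that(1,2)] unfolding a_kernel_def' by blast
  qed
  have minus_add_cancel: "(x \<ominus> p) \<oplus> p = x" if "x \<in> carrier R" "p \<in> carrier R" for x p
    using that unfolding a_minus_def by (metis R.a_assoc R.l_neg R.r_zero R.a_inv_closed)
  interpret P: primeideal P R by (rule P)
  have reflect: "x \<in> P" if x: "x \<in> carrier R" and hx: "h x \<in> h ` P" for x
  proof -
    obtain p where p: "p \<in> P" "h x = h p" using hx by blast
    have pR: "p \<in> carrier R" using p(1) by (rule P.Icarr)
    have "(x \<ominus> p) \<oplus> p \<in> P"
      using diff_in_kernel[OF x pR p(2)] ker p(1) P.a_closed by blast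
    moreover have "(x \<ominus> p) \<oplus> p = x" by (rule minus_add_cancel[OF x pR])
    ultimately show ?thesis by simp
  qed
  show ?thesis
  proof (rule primeidealI[OF ideal_image[OF P.is_ideal surj] S])
    show "carrier S \<noteq> h ` P"
    proof
      assume "carrier S = h ` P"
      hence "carrier R \<subseteq> P" using reflect hom_closed by (metis subsetI)
      thus False using P.I_notcarr P.a_subset by (metis subset_antisym)
    qed
    fix a b assume "a \<in> carrier S" "b \<in> carrier S" and ab: "a \<otimes>\<^bsub>S\<^esub> b \<in> h ` P"
    then obtain x y where xy: "x \<in> carrier R" "a = h x" "y \<in> carrier R" "b = h y"
      using surj by blast
    have "h (x \<otimes> y) \<in> h ` P" using ab xy hom_mult by metis
    hence "x \<otimes> y \<in> P" using xy(1,3) by (intro reflect R.m_closed)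
    hence "x \<in> P \<or> y \<in> P" using P.I_prime xy(1,3) by metis
    thus "a \<in> h ` P \<or> b \<in> h ` P" using xy(2,4) by (metis imageI)
  qed
qed

text \<open>Factor the preimage of an ideal and push the factors forward.  Each factor contains the whole
  product, hence the kernel, and therefore remains prime.\<close>

lemma (in ring_hom_ring) general_ZPI_ring_image:
  assumes R: "general_ZPI_ring R" and S: "nonzero_cring S" and surj: "h ` carrier R = carrier S"
  shows "general_ZPI_ring S"
  unfolding general_ZPI_ring_def
proof (intro conjI allI impI)
  show "nonzero_cring S" by (rule S)
  fix I assume "proper_ideal I S"
  hence I: "ideal I S" "I \<noteq> carrier S" by (auto simp: proper_ideal_def)
  interpret I: ideal I S by (rule I)
  define K where "K = {r \<in> carrier R. h r \<in> I}"
  have hK: "h ` K = I"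
    using surj I.a_subset by (auto simp: K_def)
  have "proper_ideal K R"
    using ideal_vimage[OF I(1)] I(2) hK surj by (auto simp: proper_ideal_def K_def)
  then obtain Ps where Ps: "\<forall>P \<in> set Ps. primeideal P R" and K: "K = ideal_list_prod R Ps"
    using R unfolding general_ZPI_ring_def by blast
  have ideals: "\<forall>P \<in> set Ps. ideal P R" using Ps primeideal.axioms(1) by blast
  have "a_kernel R S h \<subseteq> K"
    unfolding a_kernel_def' K_def using I.zero_closed by force
  hence "a_kernel R S h \<subseteq> P" if "P \<in> set Ps" for P
    using R.ideal_list_prod_subset[OF ideals that] K by blast
  hence "\<forall>Q \<in> set (map (image h) Ps). primeideal Q S"
    using Ps primeideal_image surj nonzero_cring.axioms(1)[OF S] by auto
  moreover have "I = ideal_list_prod S (map (image h) Ps)"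
    using image_ideal_list_prod[OF ideals surj] hK K by simp
  ultimately show "\<exists>Is. (\<forall>P \<in> set Is. primeideal P S) \<and> I = ideal_list_prod S Is" by blast
qed

section \<open>Ideals of a direct product\<close>

lemma RDirProd_simps:
  "carrier (RDirProd A B) = carrier A \<times> carrier B"
  "\<zero>\<^bsub>RDirProd A B\<^esub> = (\<zero>\<^bsub>A\<^esub>, \<zero>\<^bsub>B\<^esub>)"
  "\<one>\<^bsub>RDirProd A B\<^esub> = (\<one>\<^bsub>A\<^esub>, \<one>\<^bsub>B\<^esub>)"
  "(a, b) \<oplus>\<^bsub>RDirProd A B\<^esub> (a', b') = (a \<oplus>\<^bsub>A\<^esub> a', b \<oplus>\<^bsub>B\<^esub> b')"
  "(a, b) \<otimes>\<^bsub>RDirProd A B\<^esub> (a', b') = (a \<otimes>\<^bsub>A\<^esub> a', b \<otimes>\<^bsub>B\<^esub> b')"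
  by (auto simp: RDirProd_def DirProd_def monoid.defs)

locale cring_pair = A: cring A + B: cring B for A (structure) and B (structure)

sublocale cring_pair \<subseteq> AB: cring "RDirProd A B"
proof -
  interpret AB: ring "RDirProd A B"
    by (rule RDirProd_ring[OF A.ring_axioms B.ring_axioms])
  show "cring (RDirProd A B)"
    by unfold_locales (auto simp: RDirProd_simps A.m_comm B.m_comm)
qed

sublocale cring_pair \<subseteq> fst: ring_hom_ring "RDirProd A B" A fst
  by (rule ring_hom_ringI) (auto simp: RDirProd_simps A.ring_axioms AB.ring_axioms)

sublocale cring_pair \<subseteq> snd: ring_hom_ring "RDirProd A B" B snd
  by (rule ring_hom_ringI) (auto simp: RDirProd_simps B.ring_axioms AB.ring_axioms)

context cring_pair
begin

lemma fst_surj: "fst ` carrier (RDirProd A B) = carrier A"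
  using B.zero_closed by (auto simp: RDirProd_simps image_iff)

lemma snd_surj: "snd ` carrier (RDirProd A B) = carrier B"
  using A.zero_closed by (auto simp: RDirProd_simps image_iff)

lemma primeideal_times_carrier:
  assumes "primeideal P A"
  shows "primeideal (P \<times> carrier B) (RDirProd A B)"
proof -
  interpret P: primeideal P A by (rule assms)
  have "P \<times> carrier B = {r \<in> carrier (RDirProd A B). fst r \<in> P}"
    using P.Icarr by (auto simp: RDirProd_simps)
  thus ?thesis using fst.primeideal_vimage[OF AB.is_cring assms] by simp
qed

lemma primeideal_carrier_times:
  assumes "primeideal Q B"
  shows "primeideal (carrier A \<times> Q) (RDirProd A B)"
proof -
  interpret Q: primeideal Q B by (rule assms)
  have "carrier A \<times> Q = {r \<in> carrier (RDirProd A B). snd r \<in> Q}"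
    using Q.Icarr by (auto simp: RDirProd_simps)
  thus ?thesis using snd.primeideal_vimage[OF AB.is_cring assms] by simp
qed

text \<open>If \<open>(a, b)\<close> and \<open>(a', b')\<close> lie in \<open>K\<close>, so does \<open>(a, b') = (1, 0) (a, b) + (0, 1) (a', b')\<close>.\<close>

lemma ideal_RDirProd_eq_Times:
  assumes "ideal K (RDirProd A B)"
  shows "K = fst ` K \<times> snd ` K"
proof (intro equalityI subsetI)
  interpret K: ideal K "RDirProd A B" by (rule assms)
  fix z assume "z \<in> fst ` K \<times> snd ` K"
  then obtain a b a' b' where z: "z = (a, b')" and K: "(a, b) \<in> K" "(a', b') \<in> K" by force
  hence carr: "a \<in> carrier A" "b \<in> carrier B" "a' \<in> carrier A" "b' \<in> carrier B"
    using K.Icarr by (auto simp: RDirProd_simps)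
  have "(\<one>\<^bsub>A\<^esub>, \<zero>\<^bsub>B\<^esub>) \<otimes>\<^bsub>RDirProd A B\<^esub> (a, b) \<in> K" "(\<zero>\<^bsub>A\<^esub>, \<one>\<^bsub>B\<^esub>) \<otimes>\<^bsub>RDirProd A B\<^esub> (a', b') \<in> K"
    using K by (intro K.I_l_closed; simp add: RDirProd_simps)+
  hence "(a, \<zero>\<^bsub>B\<^esub>) \<in> K" "(\<zero>\<^bsub>A\<^esub>, b') \<in> K" using carr by (simp_all add: RDirProd_simps)
  hence "(a, \<zero>\<^bsub>B\<^esub>) \<oplus>\<^bsub>RDirProd A B\<^esub> (\<zero>\<^bsub>A\<^esub>, b') \<in> K" by (rule K.a_closed)
  thus "z \<in> K" using z carr by (simp add: RDirProd_simps)
qed force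

lemma ideal_prod_Times:
  assumes "ideal I A" "ideal I' A" "ideal J B" "ideal J' B"
  shows "(I \<times> J) \<cdot>\<^bsub>RDirProd A B\<^esub> (I' \<times> J') = (I \<cdot>\<^bsub>A\<^esub> I') \<times> (J \<cdot>\<^bsub>B\<^esub> J')"
    (is "?L = ?R")
proof (intro equalityI subsetI)
  fix z assume "z \<in> ?L"
  thus "z \<in> ?R"
    by (induction rule: ideal_prod.induct)
       (auto simp: RDirProd_simps intro: ideal_prod.prod ideal_prod.sum)
next
  have zeros: "\<zero>\<^bsub>A\<^esub> \<in> I" "\<zero>\<^bsub>A\<^esub> \<in> I'" "\<zero>\<^bsub>B\<^esub> \<in> J" "\<zero>\<^bsub>B\<^esub> \<in> J'"
    using assms by (auto intro: additive_subgroup.zero_closed ideal.axioms)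
  fix z assume "z \<in> ?R"
  then obtain x y where z: "z = (x, y)" and x: "x \<in> I \<cdot>\<^bsub>A\<^esub> I'" and y: "y \<in> J \<cdot>\<^bsub>B\<^esub> J'" by blast
  \<comment> \<open>The numbers of summands of \<open>x\<close> and \<open>y\<close> need not agree, so the two coordinates are
    treated separately and added up.\<close>
  have "(x, \<zero>\<^bsub>B\<^esub>) \<in> ?L"
    using x
  proof (induction rule: ideal_prod.induct)
    case (prod i j)
    thus ?case
      using ideal_prod.prod[of "(i, \<zero>\<^bsub>B\<^esub>)" "I \<times> J" "(j, \<zero>\<^bsub>B\<^esub>)" "I' \<times> J'" "RDirProd A B"] zeros
      by (simp add: RDirProd_simps)
  next
    case (sum s t)
    thus ?case using ideal_prod.sum[OF sum.IH] by (simp add: RDirProd_simps)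
  qed
  moreover have "(\<zero>\<^bsub>A\<^esub>, y) \<in> ?L"
    using y
  proof (induction rule: ideal_prod.induct)
    case (prod i j)
    thus ?case
      using ideal_prod.prod[of "(\<zero>\<^bsub>A\<^esub>, i)" "I \<times> J" "(\<zero>\<^bsub>A\<^esub>, j)" "I' \<times> J'" "RDirProd A B"] zeros
      by (simp add: RDirProd_simps)
  next
    case (sum s t)
    thus ?case using ideal_prod.sum[OF sum.IH] by (simp add: RDirProd_simps)
  qed
  ultimately have "(x, \<zero>\<^bsub>B\<^esub>) \<oplus>\<^bsub>RDirProd A B\<^esub> (\<zero>\<^bsub>A\<^esub>, y) \<in> ?L" by (rule ideal_prod.sum)
  moreover have "x \<in> carrier A" "y \<in> carrier B"
    using x y A.ideal_prod_in_carrier B.ideal_prod_in_carrier assms by blast+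
  ultimately show "z \<in> ?L" using z by (simp add: RDirProd_simps)
qed

lemma foldr_ideal_prod_times_carrier:
  assumes "\<forall>P \<in> set Ps. ideal P A" "ideal I A" "ideal J B"
  shows "foldr (ideal_prod (RDirProd A B)) (map (\<lambda>P. P \<times> carrier B) Ps) (I \<times> J) =
    foldr (ideal_prod A) Ps I \<times> J"
proof -
  have "carrier B \<cdot>\<^bsub>B\<^esub> J = J"
    using assms(3) B.ideal_prod_commute B.ideal_prod_one B.oneideal by metis
  thus ?thesis
    using assms
    by (induction Ps) (simp_all add: ideal_prod_Times A.ideal_foldr_ideal_prod B.oneideal)
qed

lemma foldr_ideal_prod_carrier_times:
  assumes "\<forall>Q \<in> set Qs. ideal Q B" "ideal I A" "ideal J B"
  shows "foldr (ideal_prod (RDirProd A B)) (map (\<lambda>Q. carrier A \<times> Q) Qs) (I \<times> J) =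
    I \<times> foldr (ideal_prod B) Qs J"
proof -
  have "carrier A \<cdot>\<^bsub>A\<^esub> I = I"
    using assms(2) A.ideal_prod_commute A.ideal_prod_one A.oneideal by metis
  thus ?thesis
    using assms
    by (induction Qs) (simp_all add: ideal_prod_Times B.ideal_foldr_ideal_prod A.oneideal)
qed

lemma ideal_list_prod_Times:
  assumes "\<forall>P \<in> set Ps. ideal P A" "\<forall>Q \<in> set Qs. ideal Q B"
  shows "ideal_list_prod (RDirProd A B)
      (map (\<lambda>P. P \<times> carrier B) Ps @ map (\<lambda>Q. carrier A \<times> Q) Qs) =
    ideal_list_prod A Ps \<times> ideal_list_prod B Qs"
  using assms
  by (simp add: ideal_list_prod_def RDirProd_simps(1) foldr_ideal_prod_carrier_times
      foldr_ideal_prod_times_carrier A.oneideal B.oneideal B.ideal_foldr_ideal_prod)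

end

section \<open>Direct products of general ZPI-rings\<close>

lemma general_ZPI_ring_ideal_factorization:
  assumes "general_ZPI_ring R" "ideal I R"
  obtains Ps where "\<forall>P \<in> set Ps. primeideal P R" "I = ideal_list_prod R Ps"
proof (cases "I = carrier R")
  case True
  \<comment> \<open>The unit ideal is the empty product.\<close>
  thus ?thesis using that[of "[]"] by (simp add: ideal_list_prod_def)
next
  case False
  thus ?thesis using assms that unfolding general_ZPI_ring_def proper_ideal_def by blast
qed

lemma nonzero_cring_RDirProd:
  assumes "nonzero_cring A" "cring B"
  shows "nonzero_cring (RDirProd A B)"
proof -
  interpret A: nonzero_cring A by (rule assms)
  interpret B: cring B by (rule assms)
  interpret cring_pair A B ..
  show ?thesis
    by unfold_locales (simp add: RDirProd_simps A.one_not_zero)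
qed

lemma general_ZPI_ring_RDirProd_iff:
  assumes A: "nonzero_cring A" and B: "nonzero_cring B"
  shows "general_ZPI_ring (RDirProd A B) \<longleftrightarrow> general_ZPI_ring A \<and> general_ZPI_ring B"
proof (intro iffI conjI)
  interpret A: nonzero_cring A by (rule A)
  interpret B: nonzero_cring B by (rule B)
  interpret cring_pair A B ..
  {
    assume "general_ZPI_ring (RDirProd A B)"
    thus "general_ZPI_ring A" "general_ZPI_ring B"
      using fst.general_ZPI_ring_image snd.general_ZPI_ring_image A B fst_surj snd_surj by blast+
  }
  assume ZPI: "general_ZPI_ring A \<and> general_ZPI_ring B"
  have "\<exists>Is. (\<forall>P \<in> set Is. primeideal P (RDirProd A B)) \<and> K = ideal_list_prod (RDirProd A B) Is"
    if K: "ideal K (RDirProd A B)" for K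
  proof -
    obtain Ps where Ps: "\<forall>P \<in> set Ps. primeideal P A" "fst ` K = ideal_list_prod A Ps"
      using general_ZPI_ring_ideal_factorization ZPI fst.ideal_image[OF K fst_surj] by blast
    obtain Qs where Qs: "\<forall>Q \<in> set Qs. primeideal Q B" "snd ` K = ideal_list_prod B Qs"
      using general_ZPI_ring_ideal_factorization ZPI snd.ideal_image[OF K snd_surj] by blast
    let ?Is = "map (\<lambda>P. P \<times> carrier B) Ps @ map (\<lambda>Q. carrier A \<times> Q) Qs"
    have "K = ideal_list_prod (RDirProd A B) ?Is"
      using ideal_RDirProd_eq_Times[OF K] ideal_list_prod_Times[of Ps Qs] Ps Qs
      by (simp add: primeideal.axioms(1))
    moreover have "\<forall>P \<in> set ?Is. primeideal P (RDirProd A B)"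
      using Ps Qs primeideal_times_carrier primeideal_carrier_times by auto
    ultimately show ?thesis by blast
  qed
  thus "general_ZPI_ring (RDirProd A B)"
    using nonzero_cring_RDirProd[OF A B.is_cring]
    by (simp add: general_ZPI_ring_def proper_ideal_def)
qed

theorem proposition2p13:
  fixes n :: nat
    and A :: "('a, 'c) ring_scheme"
    and B :: "('b, 'd) ring_scheme"
  assumes "n \<ge> 1"
    and "nonzero_cring A"
    and "nonzero_cring B"
  shows "n_OAF_ring n (RDirProd A B) \<longleftrightarrow> general_ZPI_ring A \<and> general_ZPI_ring B"
proof -
  interpret A: nonzero_cring A by (rule assms)
  interpret B: nonzero_cring B by (rule assms)
  interpret cring_pair A B ..
  have "n_OAF_ring n (RDirProd A B) \<longleftrightarrow> general_ZPI_ring (RDirProd A B)"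
    by (rule AB.n_OAF_ring_iff_general_ZPI_ring
          [OF assms(1), of "(\<one>\<^bsub>A\<^esub>, \<zero>\<^bsub>B\<^esub>)" "(\<zero>\<^bsub>A\<^esub>, \<one>\<^bsub>B\<^esub>)"])
       (simp_all add: RDirProd_simps A.one_not_zero B.one_not_zero)
  thus ?thesis using general_ZPI_ring_RDirProd_iff assms(2,3) by blast
qed

end
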